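(* Let $(\mathcal C,\prec,\wedge,h)$ be a meet entropy space. (i) If $\lambda\colon\mathcal C\to\mathcal C$ is a positively expansive morphism with positive generator $\alpha\in\mathcal C$, then $h(\lambda)=h(\lambda,\alpha)$, and this quantity is finite if $h$ is finite (i.e. $h(\beta)<\infty$ for all $\beta\in\mathcal C$) and $\lambda$ is a lower morphism. (ii) If $\lambda\colon\mathcal C\to\mathcal C$ is an expansive isomorphism with generator $\alpha\in\mathcal C$, then $h(\lambda)=h(\lambda,\alpha)$, and this quantity is finite if $h$ is finite.
   Context: An entropy space $(\mathcal C,\prec,\wedge,h)$ consists of a non-empty set $\mathcal C$, a pre-order $\prec$ on $\mathcal C$, an associative binary operation $\wedge$ on $\mathcal C$, and a function $h\colon\mathcal C\to[0,\infty]$ such that for all $\alpha,\alpha',\beta,\beta'\in\mathcal C$: $\alpha\wedge\beta\prec\alpha$ and $\alpha\wedge\beta\prec\beta$; if $\alpha\prec\alpha'$ and $\beta\prec\beta'$ then $\alpha\wedge\beta\prec\alpha'\wedge\beta'$; if $\alpha\prec\beta$ then $h(\alpha)\ge h(\beta)$; and $h(\alpha\wedge\beta)\le h(\alpha)+h(\beta)$. Write $\alpha\sim\beta$ iff $\alpha\prec\beta$ and $\beta\prec\alpha$. It is a meet entropy space if $\gamma\prec\alpha$ and $\gamma\prec\beta$ imply $\gamma\prec\alpha\wedge\beta$. A map $\lambda\colon\mathcal C\to\mathcal C$ is a morphism if it is monotone ($\alpha\prec\beta$ implies $\lambda\alpha\prec\lambda\beta$) and $\lambda(\alpha\wedge\beta)\sim\lambda\alpha\wedge\lambda\beta$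 for all $\alpha,\beta$; a lower morphism if moreover $h(\lambda\alpha)\le h(\alpha)$ for all $\alpha$; a homomorphism if it is a morphism with $h(\lambda\alpha)=h(\alpha)$ for all $\alpha$; an isomorphism if it is a bijective homomorphism whose inverse is a homomorphism. For $\alpha\in\mathcal C$ and integers $n\le m$ (with $n\ge0$, or $n\in\mathbb Z$ if $\lambda$ is bijective) put $\alpha_n^m[\lambda]=\lambda^n\alpha\wedge\lambda^{n+1}\alpha\wedge\cdots\wedge\lambda^m\alpha$. Set $h(\lambda,\alpha)=\limsup_{n\to\infty}\frac1n h(\alpha_0^{n-1}[\lambda])$ and $h(\lambda)=\sup_{\alpha\in\mathcal C}h(\lambda,\alpha)$, both in $[0,\infty]$. $\alpha\in\mathcal C$ is a positive generator for $\lambda$ if for every $\beta\in\mathcal C$ there is $m\in\mathbb N$ with $\alpha_0^m[\lambda]\prec\beta$; $\lambda$ is positively expansive if a positive generator exists. If $\lambda$ is bijective, $\alpha$ is a generator for $\lambda$ if for every $\beta\in\mathcal C$ there is $m\in\mathbb N$ with $\alpha_{-m}^m[\lambda]\prec\beta$; $\lambda$ is expansive if a generator exists. *)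

theory Defs
  imports "HOL-Library.Extended_Nonnegative_Real" "HOL-Library.FuncSet"
begin

record 'a entropy_structure =
  points :: "'a set"
  prec :: "'a \<Rightarrow> 'a \<Rightarrow> bool"  (infix \<open>\<preceq>\<index>\<close> 50)
  wedge :: "'a \<Rightarrow> 'a \<Rightarrow> 'a"  (infixl \<open>\<sqinter>\<index>\<close> 70)
  ent :: "'a \<Rightarrow> ennreal"

locale entropy_space =
  fixes E :: "('a, 'b) entropy_structure_scheme" (structure)
  assumes nonempty: "points E \<noteq> {}"
    and prec_refl: "reflp_on (points E) (\<lambda>x y. x \<preceq> y)"
    and prec_trans: "transp_on (points E) (\<lambda>x y. x \<preceq> y)"
    and wedge_closed: "\<lbrakk>x \<in> points E; y \<in> points E\<rbrakk> \<Longrightarrow> x \<sqinter> y \<in> points E"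
    and wedge_assoc: "\<lbrakk>x \<in> points E; y \<in> points E; z \<in> points E\<rbrakk>
      \<Longrightarrow> (x \<sqinter> y) \<sqinter> z = x \<sqinter> (y \<sqinter> z)"
    and wedge_lower1: "\<lbrakk>x \<in> points E; y \<in> points E\<rbrakk> \<Longrightarrow> x \<sqinter> y \<preceq> x"
    and wedge_lower2: "\<lbrakk>x \<in> points E; y \<in> points E\<rbrakk> \<Longrightarrow> x \<sqinter> y \<preceq> y"
    and wedge_mono: "\<lbrakk>x \<in> points E; x' \<in> points E; y \<in> points E; y' \<in> points E;
      x \<preceq> x'; y \<preceq> y'\<rbrakk> \<Longrightarrow> x \<sqinter> y \<preceq> x' \<sqinter> y'"
    and ent_antimono: "\<lbrakk>x \<in> points E; y \<in> points E; x \<preceq> y\<rbrakk> \<Longrightarrow> ent E x \<ge> ent E y"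
    and ent_subadd: "\<lbrakk>x \<in> points E; y \<in> points E\<rbrakk>
      \<Longrightarrow> ent E (x \<sqinter> y) \<le> ent E x + ent E y"

locale meet_entropy_space = entropy_space +
  assumes wedge_greatest: "\<lbrakk>x \<in> points E; y \<in> points E; z \<in> points E; z \<preceq> x; z \<preceq> y\<rbrakk>
    \<Longrightarrow> z \<preceq> x \<sqinter> y"

definition ent_equiv :: "('a, 'b) entropy_structure_scheme \<Rightarrow> 'a \<Rightarrow> 'a \<Rightarrow> bool"
  where "ent_equiv E x y \<longleftrightarrow> prec E x y \<and> prec E y x"

definition ent_morphism :: "('a, 'b) entropy_structure_scheme \<Rightarrow> ('a \<Rightarrow> 'a) \<Rightarrow> bool"
  where "ent_morphism E l \<longleftrightarrow>
    l \<in> points E \<rightarrow> points E \<and>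
    (\<forall>x\<in>points E. \<forall>y\<in>points E. prec E x y \<longrightarrow> prec E (l x) (l y)) \<and>
    (\<forall>x\<in>points E. \<forall>y\<in>points E. ent_equiv E (l (wedge E x y)) (wedge E (l x) (l y)))"

definition ent_lower_morphism :: "('a, 'b) entropy_structure_scheme \<Rightarrow> ('a \<Rightarrow> 'a) \<Rightarrow> bool"
  where "ent_lower_morphism E l \<longleftrightarrow>
    ent_morphism E l \<and> (\<forall>x\<in>points E. ent E (l x) \<le> ent E x)"

definition ent_homomorphism :: "('a, 'b) entropy_structure_scheme \<Rightarrow> ('a \<Rightarrow> 'a) \<Rightarrow> bool"
  where "ent_homomorphism E l \<longleftrightarrow>
    ent_morphism E l \<and> (\<forall>x\<in>points E. ent E (l x) = ent E x)"

definition ent_isomorphism :: "('a, 'b) entropy_structure_scheme \<Rightarrow> ('a \<Rightarrow> 'a) \<Rightarrow> bool"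
  where "ent_isomorphism E l \<longleftrightarrow>
    bij_betw l (points E) (points E) \<and> ent_homomorphism E l \<and>
    ent_homomorphism E (inv_into (points E) l)"

(* Negative powers are meaningful only if l is a bijection of points E. *)
definition int_iterate :: "('a, 'b) entropy_structure_scheme \<Rightarrow> ('a \<Rightarrow> 'a) \<Rightarrow> int \<Rightarrow> 'a \<Rightarrow> 'a"
  where "int_iterate E l k =
    (if k \<ge> 0 then l ^^ nat k else inv_into (points E) l ^^ nat (- k))"

primrec wedge_seq :: "('a, 'b) entropy_structure_scheme \<Rightarrow> (nat \<Rightarrow> 'a) \<Rightarrow> nat \<Rightarrow> 'a"
  where
    "wedge_seq E f 0 = f 0"
  | "wedge_seq E f (Suc k) = wedge E (wedge_seq E f k) (f (Suc k))"

(* The wedge of the iterates of a with exponents n, n + 1, ..., m; only used for n \<le> m. *)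
definition orbit_wedge ::
    "('a, 'b) entropy_structure_scheme \<Rightarrow> ('a \<Rightarrow> 'a) \<Rightarrow> 'a \<Rightarrow> int \<Rightarrow> int \<Rightarrow> 'a"
  where "orbit_wedge E l a n m =
    wedge_seq E (\<lambda>i. int_iterate E l (n + int i) a) (nat (m - n))"

(* The term at n = 0 is a junk value, which does not affect the limsup. *)
definition entropy_at :: "('a, 'b) entropy_structure_scheme \<Rightarrow> ('a \<Rightarrow> 'a) \<Rightarrow> 'a \<Rightarrow> ennreal"
  where "entropy_at E l a =
    limsup (\<lambda>n. ent E (orbit_wedge E l a 0 (int n - 1)) / of_nat n)"

definition entropy :: "('a, 'b) entropy_structure_scheme \<Rightarrow> ('a \<Rightarrow> 'a) \<Rightarrow> ennreal"
  where "entropy E l = (SUP a\<in>points E. entropy_at E l a)"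

definition positive_generator :: "('a, 'b) entropy_structure_scheme \<Rightarrow> ('a \<Rightarrow> 'a) \<Rightarrow> 'a \<Rightarrow> bool"
  where "positive_generator E l a \<longleftrightarrow>
    a \<in> points E \<and> (\<forall>b\<in>points E. \<exists>m::nat. prec E (orbit_wedge E l a 0 (int m)) b)"

definition positively_expansive :: "('a, 'b) entropy_structure_scheme \<Rightarrow> ('a \<Rightarrow> 'a) \<Rightarrow> bool"
  where "positively_expansive E l \<longleftrightarrow> (\<exists>a. positive_generator E l a)"

definition generator :: "('a, 'b) entropy_structure_scheme \<Rightarrow> ('a \<Rightarrow> 'a) \<Rightarrow> 'a \<Rightarrow> bool"
  where "generator E l a \<longleftrightarrow>
    bij_betw l (points E) (points E) \<and> a \<in> points E \<and>
    (\<forall>b\<in>points E. \<exists>m::nat. prec E (orbit_wedge E l a (- int m) (int m)) b)"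

definition expansive :: "('a, 'b) entropy_structure_scheme \<Rightarrow> ('a \<Rightarrow> 'a) \<Rightarrow> bool"
  where "expansive E l \<longleftrightarrow> (\<exists>a. generator E l a)"

definition finite_entropy :: "('a, 'b) entropy_structure_scheme \<Rightarrow> bool"
  where "finite_entropy E \<longleftrightarrow> (\<forall>b\<in>points E. ent E b < \<infinity>)"

end

theory Submission
  imports Defs
begin

text \<open>
  A generator \<open>\<alpha>\<close> refines every \<open>\<beta>\<close> at the cost of a window of fixed length: some finite piece
  \<open>W\<close> of its orbit, of length \<open>r + 1\<close>, lies below \<open>\<beta>\<close>.  Applying \<open>\<lambda>\<close> repeatedly moves this
  window along the orbit, so the first \<open>n + 1\<close> iterates of \<open>\<beta>\<close> all lie above an orbit piece of
  \<open>\<alpha>\<close> of length \<open>n + r + 1\<close>; since \<open>\<wedge>\<close> is a greatest lower bound up to equivalence, so does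
  their wedge (\<open>forward_wedge_dominates\<close>).  Entropy is antitone, and the fixed excess \<open>r\<close> is
  invisible after dividing by \<open>n\<close> and passing to the limit superior
  (\<open>limsup_average_shift\<close>), whence \<open>h(\<lambda>,\<beta>) \<le> h(\<lambda>,\<alpha>)\<close>.

  Both kinds of generators are handled together by looking only at forward orbits.  For a positive
  generator the window starts at \<open>\<alpha>\<close>.  For a two-sided one it starts at
  \<open>c = \<lambda>\<^sup>-\<^sup>m \<alpha>\<close>, and because \<open>\<lambda>\<close> preserves entropy, pushing the orbit piece of \<open>c\<close>
  forward by \<open>\<lambda>\<^sup>m\<close> bounds its entropy by that of the orbit piece of \<open>\<alpha>\<close>
  (\<open>ent_forward_wedge_le_shift\<close>).

  Finiteness is subadditivity: if \<open>\<lambda>\<close> does not increase entropy, the wedge of \<open>n\<close> iterates of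
  \<open>\<alpha>\<close> has entropy at most \<open>n h(\<alpha>)\<close>.
\<close>

section \<open>Averages along a shifted sequence\<close>

text \<open>
  The ratio \<open>(n + r) / n\<close> tends to \<open>1\<close>, so replacing \<open>n\<close> by \<open>n + r\<close> in the numerator does not
  change the limiting average.  The factor is absorbed between two numbers above the limit
  superior, the lower of which is necessarily finite; if the limit superior is \<open>\<infinity>\<close> there is
  nothing to show.
\<close>

lemma limsup_average_shift:
  fixes f g :: "nat \<Rightarrow> ennreal"
  assumes le: "\<And>n. n > 0 \<Longrightarrow> f n \<le> g (n + r)"
  shows "limsup (\<lambda>n. f n / of_nat n) \<le> limsup (\<lambda>n. g n / of_nat n)"
proof (rule Limsup_le_iff[THEN iffD2], intro allI impI)
  fix y assume "limsup (\<lambda>n. g n / of_nat n) < y"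
  then obtain z where z: "limsup (\<lambda>n. g n / of_nat n) < z" "z < y"
    using dense by blast
  then have z_fin: "z < top"
    using top.not_eq_extremum by fastforce
  have "\<forall>\<^sub>F n in sequentially. g n / of_nat n < z"
    by (rule Limsup_lessD[OF z(1)])
  then have "\<forall>\<^sub>F n in sequentially. g (n + r) / of_nat (n + r) < z"
    by (rule eventually_sequentially_seg[THEN iffD2])
  moreover have "\<forall>\<^sub>F n in sequentially. z * ennreal (real (n + r) / real n) < y"
  proof (rule order_tendstoD(2)[OF _ z(2)])
    have "(\<lambda>n. 1 + real r / real n) \<longlonglongrightarrow> 1 + 0"
      by (intro tendsto_intros lim_const_over_n)
    moreover have "\<forall>\<^sub>F n in sequentially. 1 + real r / real n = real (n + r) / real n"
      using eventually_gt_at_top[of 0] by eventually_elim (simp add: field_simps)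
    ultimately have "(\<lambda>n. real (n + r) / real n) \<longlonglongrightarrow> 1"
      using tendsto_cong by force
    then have "(\<lambda>n. ennreal (real (n + r) / real n)) \<longlonglongrightarrow> ennreal 1"
      by (rule tendsto_ennrealI)
    then have "(\<lambda>n. z * ennreal (real (n + r) / real n)) \<longlonglongrightarrow> z * ennreal 1"
      by (rule ennreal_tendsto_cmult[OF z_fin])
    then show "(\<lambda>n. z * ennreal (real (n + r) / real n)) \<longlonglongrightarrow> z"
      by simp
  qed
  ultimately show "\<forall>\<^sub>F n in sequentially. f n / of_nat n < y"
    using eventually_gt_at_top[of 0]
  proof eventually_elim
    case (elim n)
    have ratio: "ennreal (real (n + r) / real n) = of_nat (n + r) / of_nat n"
      using elim(3) by (simp add: divide_ennreal[symmetric] flip: ennreal_of_nat_eq_real_of_nat)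
    have "f n / of_nat n \<le> g (n + r) / of_nat n"
      using le[OF elim(3)] by (rule divide_right_mono_ennreal)
    also have "\<dots> = g (n + r) / of_nat (n + r) * (of_nat (n + r) / of_nat n)"
      using elim(3)
      by (simp add: ennreal_times_divide ennreal_divide_times ennreal_mult_divide_eq
            del: of_nat_add)
    also have "\<dots> \<le> z * (of_nat (n + r) / of_nat n)"
      using elim(1) by (intro mult_right_mono) auto
    also have "\<dots> < y"
      using elim(2) ratio by simp
    finally show ?case .
  qed
qed

section \<open>Wedges of forward orbits\<close>

context entropy_space
begin

abbreviation forward_wedge :: "('a \<Rightarrow> 'a) \<Rightarrow> 'a \<Rightarrow> nat \<Rightarrow> 'a"
  where "forward_wedge l c k \<equiv> wedge_seq E (\<lambda>i. (l ^^ i) c) k"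

lemma prec_reflD: "x \<in> points E \<Longrightarrow> x \<preceq> x"
  using prec_refl by (rule reflp_onD)

lemma prec_transD:
  "\<lbrakk>x \<preceq> y; y \<preceq> z; x \<in> points E; y \<in> points E; z \<in> points E\<rbrakk> \<Longrightarrow> x \<preceq> z"
  using prec_trans by (meson transp_onD)

lemma wedge_seq_closed:
  "(\<And>i. f i \<in> points E) \<Longrightarrow> wedge_seq E f k \<in> points E"
  by (induction k) (auto intro: wedge_closed)

lemma wedge_seq_lower:
  assumes "\<And>i. f i \<in> points E" and "i \<le> k"
  shows "wedge_seq E f k \<preceq> f i"
  using assms(2)
proof (induction k)
  case 0
  then show ?case
    using assms(1) by (simp add: prec_reflD)
next
  case (Suc k)
  show ?case
  proof (cases "i \<le> k")
    case True
    then show ?thesis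
      using Suc.IH assms(1) wedge_seq_closed[OF assms(1)]
      by (auto intro!: prec_transD[OF wedge_lower1] wedge_closed)
  next
    case False
    then have "i = Suc k"
      using Suc.prems by simp
    then show ?thesis
      using assms(1) wedge_seq_closed[OF assms(1)] by (auto intro: wedge_lower2)
  qed
qed

lemma ent_wedge_seq_le:
  assumes "\<And>i. f i \<in> points E" and "\<And>i. ent E (f i) \<le> M"
  shows "ent E (wedge_seq E f k) \<le> of_nat (Suc k) * M"
proof (induction k)
  case 0
  then show ?case
    using assms(2) by simp
next
  case (Suc k)
  have "ent E (wedge_seq E f (Suc k)) \<le> ent E (wedge_seq E f k) + ent E (f (Suc k))"
    using assms(1) wedge_seq_closed[OF assms(1)] by (simp add: ent_subadd)
  also have "\<dots> \<le> of_nat (Suc k) * M + M"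
    using Suc.IH assms(2) by (rule add_mono)
  also have "\<dots> = of_nat (Suc (Suc k)) * M"
    by (simp add: algebra_simps)
  finally show ?case .
qed

lemma entropy_at_forward_wedge:
  "entropy_at E l a = limsup (\<lambda>n. ent E (forward_wedge l a (n - 1)) / of_nat n)"
proof -
  have "nat (int n - 1) = n - 1" for n
    by simp
  then show ?thesis
    by (simp add: entropy_at_def orbit_wedge_def int_iterate_def)
qed

lemma morphism_iterate_closed:
  "\<lbrakk>ent_morphism E l; x \<in> points E\<rbrakk> \<Longrightarrow> (l ^^ i) x \<in> points E"
  by (induction i) (auto simp: ent_morphism_def)

lemma morphism_iterate_mono:
  assumes "ent_morphism E l" "x \<in> points E" "y \<in> points E" "x \<preceq> y"
  shows "(l ^^ i) x \<preceq> (l ^^ i) y"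
proof (induction i)
  case (Suc i)
  then show ?case
    using assms morphism_iterate_closed[OF assms(1)] by (simp add: ent_morphism_def)
qed (use assms in simp)

lemma wedge_seq_image_prec:
  assumes l: "ent_morphism E l" and f: "\<And>i. f i \<in> points E"
  shows "wedge_seq E (\<lambda>i. l (f i)) k \<preceq> l (wedge_seq E f k)"
proof -
  have lP: "l x \<in> points E" if "x \<in> points E" for x
    using l that by (auto simp: ent_morphism_def)
  have wP: "wedge_seq E f k \<in> points E" for k
    by (rule wedge_seq_closed) (rule f)
  have lwP: "wedge_seq E (\<lambda>i. l (f i)) k \<in> points E" for k
    by (rule wedge_seq_closed) (rule lP[OF f])
  show ?thesis
  proof (induction k)
    case 0
    then show ?case
      using prec_reflD[OF lP[OF f]] by simp
  next
    case (Suc k)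
    have "wedge_seq E (\<lambda>i. l (f i)) (Suc k) \<preceq> l (wedge_seq E f k) \<sqinter> l (f (Suc k))"
      using Suc.IH by (simp add: wedge_mono f lP wP lwP prec_reflD)
    moreover have "l (wedge_seq E f k) \<sqinter> l (f (Suc k)) \<preceq> l (wedge_seq E f (Suc k))"
      using l f wP by (auto simp: ent_morphism_def ent_equiv_def)
    ultimately show ?case
      by (rule prec_transD) (intro lwP wedge_closed lP wP f)+
  qed
qed

lemma forward_wedge_shift_prec:
  assumes l: "ent_morphism E l" and c: "c \<in> points E"
  shows "forward_wedge l ((l ^^ p) c) k \<preceq> (l ^^ p) (forward_wedge l c k)"
proof (induction p)
  case 0
  have "forward_wedge l c k \<in> points E"
    by (rule wedge_seq_closed) (rule morphism_iterate_closed[OF l c])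
  then show ?case
    by (simp add: prec_reflD)
next
  case (Suc p)
  have iP: "(l ^^ i) x \<in> points E" if "x \<in> points E" for i x
    using morphism_iterate_closed[OF l that] .
  have wP: "forward_wedge l x k \<in> points E" if "x \<in> points E" for x
    by (rule wedge_seq_closed) (rule iP[OF that])
  have lP: "l x \<in> points E" if "x \<in> points E" for x
    using iP[OF that, of 1] by simp
  have "forward_wedge l ((l ^^ Suc p) c) k = wedge_seq E (\<lambda>i. l ((l ^^ i) ((l ^^ p) c))) k"
    by (simp add: funpow_swap1)
  also have "\<dots> \<preceq> l (forward_wedge l ((l ^^ p) c) k)"
    by (rule wedge_seq_image_prec[OF l]) (rule iP[OF iP[OF c]])
  finally have "forward_wedge l ((l ^^ Suc p) c) k \<preceq> l (forward_wedge l ((l ^^ p) c) k)" .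
  moreover have "l (forward_wedge l ((l ^^ p) c) k) \<preceq> (l ^^ Suc p) (forward_wedge l c k)"
    using l Suc.IH wP iP c by (auto simp: ent_morphism_def)
  ultimately show ?case
    by (rule prec_transD) (intro wP lP iP c)+
qed

text \<open>
  Moving an orbit piece forward by an entropy preserving morphism leaves its entropy unchanged,
  while the wedge of the moved iterates is at least as fine as the moved wedge.  This is what
  replaces a window starting at \<open>\<lambda>\<^sup>-\<^sup>m \<alpha>\<close> by one starting at \<open>\<alpha>\<close>.
\<close>

lemma ent_forward_wedge_le_shift:
  assumes l: "ent_homomorphism E l" and c: "c \<in> points E"
  shows "ent E (forward_wedge l c k) \<le> ent E (forward_wedge l ((l ^^ p) c) k)"
proof -
  have m: "ent_morphism E l"
    using l by (simp add: ent_homomorphism_def)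
  have iP: "(l ^^ i) x \<in> points E" if "x \<in> points E" for i x
    using morphism_iterate_closed[OF m that] .
  have wP: "forward_wedge l x k \<in> points E" if "x \<in> points E" for x
    by (rule wedge_seq_closed) (rule iP[OF that])
  have "ent E ((l ^^ p) (forward_wedge l c k)) = ent E (forward_wedge l c k)"
    using l iP[OF wP[OF c]] by (induction p) (auto simp: ent_homomorphism_def)
  then show ?thesis
    using ent_antimono[OF _ _ forward_wedge_shift_prec[OF m c]] iP wP c by metis
qed

lemma entropy_at_le_ent:
  assumes "ent_lower_morphism E l" and a: "a \<in> points E"
  shows "entropy_at E l a \<le> ent E a"
proof -
  have m: "ent_morphism E l" and le: "\<And>x. x \<in> points E \<Longrightarrow> ent E (l x) \<le> ent E x"
    using assms(1) by (auto simp: ent_lower_morphism_def)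
  note iP = morphism_iterate_closed[OF m a]
  have it: "ent E ((l ^^ i) a) \<le> ent E a" for i
  proof (induction i)
    case (Suc i)
    then show ?case
      using le[OF iP[of i]] by simp
  qed simp
  have "\<forall>\<^sub>F n in sequentially. ent E (forward_wedge l a (n - 1)) / of_nat n \<le> ent E a"
    using eventually_gt_at_top[of 0]
  proof eventually_elim
    case (elim n)
    have "ent E (forward_wedge l a (n - 1)) \<le> ent E a * of_nat n"
      using ent_wedge_seq_le[of "\<lambda>i. (l ^^ i) a", OF iP it, of "n - 1"] elim
      by (simp add: mult.commute)
    then have "ent E (forward_wedge l a (n - 1)) / of_nat n \<le> ent E a * of_nat n / of_nat n"
      by (rule divide_right_mono_ennreal)
    also have "\<dots> = ent E a"
      using elim by (simp add: ennreal_mult_divide_eq)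
    finally show ?case .
  qed
  then show ?thesis
    unfolding entropy_at_forward_wedge by (rule Limsup_bounded)
qed

lemma inv_into_iterate_closed:
  assumes "bij_betw l (points E) (points E)" "x \<in> points E"
  shows "(inv_into (points E) l ^^ i) x \<in> points E"
proof (induction i)
  case (Suc i)
  then show ?case
    using bij_betwE[OF bij_betw_inv_into[OF assms(1)]] by simp
qed (use assms in simp)

lemma int_iterate_step:
  assumes l: "bij_betw l (points E) (points E)" and x: "x \<in> points E"
  shows "int_iterate E l (k + 1) x = l (int_iterate E l k x)"
proof (cases "k \<ge> 0")
  case True
  then show ?thesis
    by (simp add: int_iterate_def nat_add_distrib)
next
  case False
  define j where "j = nat (- k - 1)"
  have k: "k = - int (Suc j)"
    using False by (simp add: j_def)
  have "int_iterate E l (k + 1) x = (inv_into (points E) l ^^ j) x"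
    by (auto simp: int_iterate_def k)
  also have "\<dots> = l (inv_into (points E) l ((inv_into (points E) l ^^ j) x))"
    using inv_into_iterate_closed[OF l x] bij_betw_inv_into_right[OF l] by simp
  also have "\<dots> = l (int_iterate E l k x)"
    by (simp add: int_iterate_def k nat_add_distrib)
  finally show ?thesis .
qed

text \<open>
  A two-sided orbit piece that begins at exponent \<open>-m\<close> is a forward orbit piece of the point
  \<open>\<lambda>\<^sup>-\<^sup>m x\<close>, so nothing about two-sided orbits has to be proved separately.
\<close>

lemma int_iterate_from_past:
  assumes l: "bij_betw l (points E) (points E)" and x: "x \<in> points E"
  shows "int_iterate E l (int i - int m) x = (l ^^ i) ((inv_into (points E) l ^^ m) x)"
proof (induction i)
  case 0
  show ?case
    by (auto simp: int_iterate_def)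
next
  case (Suc i)
  have "int_iterate E l (int (Suc i) - int m) x = int_iterate E l ((int i - int m) + 1) x"
    by (simp add: algebra_simps)
  then show ?case
    using int_iterate_step[OF l x] Suc.IH by simp
qed

end

section \<open>Generators attain the entropy\<close>

context meet_entropy_space
begin

lemma wedge_seq_greatest:
  assumes "\<And>i. f i \<in> points E" and "z \<in> points E" and "\<And>i. i \<le> k \<Longrightarrow> z \<preceq> f i"
  shows "z \<preceq> wedge_seq E f k"
  using assms(3)
  by (induction k) (simp_all add: assms(1,2) wedge_greatest wedge_seq_closed)

text \<open>
  For \<open>i \<le> n\<close> the window \<open>c, \<dots>, \<lambda>\<^sup>r c\<close> moved by \<open>\<lambda>\<^sup>i\<close> stays inside
  \<open>c, \<dots>, \<lambda>\<^sup>n\<^sup>+\<^sup>r c\<close>, and its wedge lies below \<open>\<lambda>\<^sup>i b\<close>.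
\<close>

lemma forward_wedge_dominates:
  assumes l: "ent_morphism E l" and c: "c \<in> points E" and b: "b \<in> points E"
    and cb: "forward_wedge l c r \<preceq> b"
  shows "forward_wedge l c (n + r) \<preceq> forward_wedge l b n"
proof (rule wedge_seq_greatest)
  have iP: "(l ^^ i) x \<in> points E" if "x \<in> points E" for i x
    using morphism_iterate_closed[OF l that] .
  have wP: "forward_wedge l x k \<in> points E" if "x \<in> points E" for x k
    by (rule wedge_seq_closed) (rule iP[OF that])
  show "(l ^^ i) b \<in> points E" for i
    by (rule iP[OF b])
  show "forward_wedge l c (n + r) \<in> points E"
    by (rule wP[OF c])
  fix i assume "i \<le> n"
  have "forward_wedge l c (n + r) \<preceq> forward_wedge l ((l ^^ i) c) r"
  proof (rule wedge_seq_greatest)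
    fix j assume "j \<le> r"
    then have "forward_wedge l c (n + r) \<preceq> (l ^^ (j + i)) c"
      using \<open>i \<le> n\<close> by (intro wedge_seq_lower iP c) simp
    then show "forward_wedge l c (n + r) \<preceq> (l ^^ j) ((l ^^ i) c)"
      by (simp add: funpow_add)
  qed (intro iP wP c)+
  then have "forward_wedge l c (n + r) \<preceq> (l ^^ i) (forward_wedge l c r)"
    using forward_wedge_shift_prec[OF l c] by (rule prec_transD) (intro iP wP c)+
  then show "forward_wedge l c (n + r) \<preceq> (l ^^ i) b"
    using morphism_iterate_mono[OF l wP[OF c] b cb] by (rule prec_transD) (intro iP wP b c)+
qed

text \<open>
  The window may start at a point \<open>c\<close> other than \<open>a\<close>, as long as its entropies are controlled
  by those of \<open>a\<close>; for a two-sided generator \<open>c\<close> lies in the past of \<open>a\<close>.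
\<close>

lemma entropy_at_le_of_window:
  assumes l: "ent_morphism E l" and c: "c \<in> points E" and b: "b \<in> points E"
    and cb: "forward_wedge l c r \<preceq> b"
    and ca: "\<And>k. ent E (forward_wedge l c k) \<le> ent E (forward_wedge l a k)"
  shows "entropy_at E l b \<le> entropy_at E l a"
  unfolding entropy_at_forward_wedge
proof (rule limsup_average_shift)
  have wP: "forward_wedge l x k \<in> points E" if "x \<in> points E" for x k
    by (rule wedge_seq_closed) (rule morphism_iterate_closed[OF l that])
  fix n :: nat assume "n > 0"
  have "ent E (forward_wedge l b (n - 1)) \<le> ent E (forward_wedge l c (n - 1 + r))"
    by (rule ent_antimono[OF wP[OF c] wP[OF b] forward_wedge_dominates[OF l c b cb]])
  also have "\<dots> \<le> ent E (forward_wedge l a (n - 1 + r))"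
    by (rule ca)
  also have "n - 1 + r = n + r - 1"
    using \<open>n > 0\<close> by simp
  finally show "ent E (forward_wedge l b (n - 1)) \<le> ent E (forward_wedge l a (n + r - 1))" .
qed

lemma entropy_eqI:
  assumes "a \<in> points E" and "\<And>b. b \<in> points E \<Longrightarrow> entropy_at E l b \<le> entropy_at E l a"
  shows "entropy E l = entropy_at E l a"
  unfolding entropy_def using assms by (intro antisym SUP_least SUP_upper)

lemma entropy_eq_positive_generator:
  assumes l: "ent_morphism E l" and "positive_generator E l a"
  shows "entropy E l = entropy_at E l a"
proof (rule entropy_eqI)
  show a: "a \<in> points E"
    using assms(2) by (simp add: positive_generator_def)
  fix b assume b: "b \<in> points E"
  then obtain m :: nat where "orbit_wedge E l a 0 (int m) \<preceq> b"
    using assms(2) by (auto simp: positive_generator_def)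
  then have "forward_wedge l a m \<preceq> b"
    by (simp add: orbit_wedge_def int_iterate_def)
  then show "entropy_at E l b \<le> entropy_at E l a"
    by (rule entropy_at_le_of_window[OF l a b]) simp
qed

lemma entropy_eq_generator:
  assumes iso: "ent_isomorphism E l" and "generator E l a"
  shows "entropy E l = entropy_at E l a"
proof (rule entropy_eqI)
  show a: "a \<in> points E"
    using assms(2) by (simp add: generator_def)
  have bij: "bij_betw l (points E) (points E)" and hom: "ent_homomorphism E l"
    using iso by (auto simp: ent_isomorphism_def)
  fix b assume b: "b \<in> points E"
  then obtain m :: nat where m: "orbit_wedge E l a (- int m) (int m) \<preceq> b"
    using assms(2) by (auto simp: generator_def)
  define c where "c = (inv_into (points E) l ^^ m) a"
  have c: "c \<in> points E"
    unfolding c_def by (rule inv_into_iterate_closed[OF bij a])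
  have iter: "int_iterate E l (int i - int m) a = (l ^^ i) c" for i
    unfolding c_def by (rule int_iterate_from_past[OF bij a])
  have ca: "(l ^^ m) c = a"
    using iter[of m] by (simp add: int_iterate_def)
  have "nat (int m - (- int m)) = 2 * m"
    by simp
  then have "forward_wedge l c (2 * m) \<preceq> b"
    using m iter by (simp add: orbit_wedge_def)
  then show "entropy_at E l b \<le> entropy_at E l a"
    using hom ent_forward_wedge_le_shift[OF hom c, of _ m]
    by (intro entropy_at_le_of_window[OF _ c b]) (simp_all add: ent_homomorphism_def ca)
qed

end

theorem proposition3p1p4:
  fixes E :: "('a, 'b) entropy_structure_scheme"
  assumes "meet_entropy_space E"
  shows "(\<forall>l a. ent_morphism E l \<and> positively_expansive E l \<and> positive_generator E l a \<longrightarrow>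
            entropy E l = entropy_at E l a \<and>
            (finite_entropy E \<and> ent_lower_morphism E l \<longrightarrow> entropy E l < \<infinity>)) \<and>
         (\<forall>l a. ent_isomorphism E l \<and> expansive E l \<and> generator E l a \<longrightarrow>
            entropy E l = entropy_at E l a \<and>
            (finite_entropy E \<longrightarrow> entropy E l < \<infinity>))"
proof -
  interpret meet_entropy_space E
    by (rule assms)
  have finite: "entropy_at E l a < \<infinity>"
    if "finite_entropy E" "ent_lower_morphism E l" "a \<in> points E" for l a
    using entropy_at_le_ent[OF that(2,3)] that(1,3)
    by (auto simp: finite_entropy_def intro: le_less_trans)
  have lower: "ent_lower_morphism E l" if "ent_isomorphism E l" for l
    using that by (simp add: ent_isomorphism_def ent_homomorphism_def ent_lower_morphism_def)
  show ?thesis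
    using entropy_eq_positive_generator entropy_eq_generator finite lower
    by (auto simp: positive_generator_def generator_def)
qed

end
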